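(* Let $\lambda>0$ and $0\le\mu<1$, and assume: (1) there is $C_m>0$ such that for every $\theta\in\mathbb{R}^{N_p}$, $\mathbb{E}_{X\sim\pi_\theta}\big[\|\nabla_\theta\log|\psi_\theta(X)|\|^4\big]\le C_m$ and $\mathbb{E}_{X\sim\pi_\theta}\big[E_{\mathrm{loc}}(\theta;X)^4\big]\le C_m$; (2) there is $C_g>0$ such that $\|g(\theta)-g(\theta')\|\le C_g\|\theta-\theta'\|$ for all $\theta,\theta'\in\mathbb{R}^{N_p}$; (3) the step sizes satisfy $0<\eta_k\le\eta_{k-1}$ for all $k\ge1$, and $0<\eta_0\le \frac{2\lambda(1-\mu)}{C_g}$. Let $\{\theta_k\}_{k\ge0}$ be generated, from given initial vectors $\theta_0,\Delta\theta_{-1}\in\mathbb{R}^{N_p}$, by the full-batch SPRING iteration $$\Delta\theta_k=(\lambda I+S(\theta_k))^{-1}\Big(\lambda\mu\,\Delta\theta_{k-1}-\tfrac12 g(\theta_k)\Big),\qquad \theta_{k+1}=\theta_k+\eta_k\Delta\theta_k,\qquad k\ge 0.$$ Then: (a) if $\sum_k\eta_k=\infty$, then $\min_{1\le k\le K}\|g(\theta_k)\|^2=\mathcal{O}\Big(\frac{1}{\sum_{k=1}^K\eta_k}\Big)$ (as a function of $K$) and $\liminf_{k\to\infty}\|g(\theta_k)\|=0$; (b) if $\eta_k\equiv\eta>0$ is constant, then $\lim_{k\to\infty}g(\theta_k)=0$.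
   Context: Variational Monte Carlo setting. $N$ is the number of particles, $\Omega$ the single-particle configuration space (continuous, or discrete, in which case integrals over $\Omega^N$ denote sums), and $\mathscr{H}$ is a self-adjoint Hamiltonian acting on functions on $\Omega^N$. $\{\psi_\theta\}_{\theta\in\mathbb{R}^{N_p}}$ is a parametrized family of nonzero square-integrable real-valued wavefunctions $\psi_\theta:\Omega^N\to\mathbb{R}$. Define: - $\pi_\theta(x)=|\psi_\theta(x)|^2/\int|\psi_\theta|^2$, a probability density (or mass function) on $\Omega^N$; - local energy $E_{\mathrm{loc}}(\theta;x)=(\mathscr{H}\psi_\theta)(x)/\psi_\theta(x)$; - energy $L(\theta)=\langle\psi_\theta|\mathscr{H}|\psi_\theta\rangle/\langle\psi_\theta|\psi_\theta\rangle=\mathbb{E}_{X\sim\pi_\theta}[E_{\mathrm{loc}}(\theta;X)]$; - $\bar E(\theta;x)=E_{\mathrm{loc}}(\theta;x)-L(\theta)\in\mathbb{R}$ and $O(\theta;x)=\nabla_\theta\log|\psi_\theta(x)|-\mathbb{E}_{X\sim\pi_\theta}[\nabla_\theta\log|\psi_\theta(X)|]\in\mathbb{R}^{N_p}$; - gradient $g(\theta)=\nabla_\theta L(\theta)$, for which the standard VMC identity $g(\theta)=2\,\mathbb{E}_{X\sim\pi_\theta}[\bar E(\theta;X)O(\theta;X)]$ holds (standing assumption of the setting); - SR matrix $S(\theta)=\mathbb{E}_{X\sim\pi_\theta}[O(\theta;X)O(\theta;X)^\top]\in\mathbb{R}^{N_p\times N_p}$. $\|\cdot\|$ is the Euclidean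 norm. In the algorithm of interest $\Delta\theta_{-1}=0$. *)

theory Defs
  imports "HOL-Probability.Probability"
begin

section \<open>Gradients\<close>

text \<open>The gradient vector; only meaningful at points of differentiability.\<close>

definition gradient :: "('a::real_inner \<Rightarrow> real) \<Rightarrow> 'a \<Rightarrow> 'a" where
  "gradient f x = (THE D. GDERIV f x :> D)"

section \<open>Self-adjoint operators on a real L2 space\<close>

text \<open>
  Elements of L2 are represented by functions. Wavefunctions and local energies are
  real-valued throughout, so the underlying Hilbert space is the real one.
\<close>

definition L2_funs :: "'x measure \<Rightarrow> ('x \<Rightarrow> real) set" where
  "L2_funs M = {f. f \<in> borel_measurable M \<and> integrable M (\<lambda>x. (f x)\<^sup>2)}"

definition L2_inner :: "'x measure \<Rightarrow> ('x \<Rightarrow> real) \<Rightarrow> ('x \<Rightarrow> real) \<Rightarrow> real" where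
  "L2_inner M f g = (\<integral>x. f x * g x \<partial>M)"

text \<open>
  The last conjunct says that the graph of the adjoint of \<open>H\<close> is the graph of \<open>H\<close>
  (up to null sets), i.e. \<open>H\<close> equals its adjoint, including equality of the domains. Since the
  equivalence is over all functions \<open>f\<close>, \<open>u\<close>, it also makes \<open>D\<close> closed under changes on
  null sets and \<open>H\<close> well defined on equivalence classes.
\<close>

definition self_adjoint_operator ::
    "'x measure \<Rightarrow> ('x \<Rightarrow> real) set \<Rightarrow> (('x \<Rightarrow> real) \<Rightarrow> ('x \<Rightarrow> real)) \<Rightarrow> bool" where
  "self_adjoint_operator M D H \<longleftrightarrow>
     D \<subseteq> L2_funs M \<and>
     H ` D \<subseteq> L2_funs M \<and>
     (\<lambda>x. 0) \<in> D \<and>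
     (\<forall>f\<in>D. \<forall>h\<in>D. \<forall>a b. (\<lambda>x. a * f x + b * h x) \<in> D \<and>
        (AE x in M. H (\<lambda>x. a * f x + b * h x) x = a * H f x + b * H h x)) \<and>
     (\<forall>f\<in>L2_funs M. \<forall>\<epsilon>>0. \<exists>h\<in>D. (\<integral>x. (f x - h x)\<^sup>2 \<partial>M) < \<epsilon>) \<and>
     (\<forall>f\<in>L2_funs M. \<forall>u\<in>L2_funs M.
        (\<forall>h\<in>D. L2_inner M f (H h) = L2_inner M u h) \<longleftrightarrow> (f \<in> D \<and> (AE x in M. u x = H f x)))"

section \<open>Variational Monte Carlo\<close>

text \<open>
  Configurations of \<open>N\<close> particles over the single-particle measure space \<open>\<Omega>\<close>: Lebesgue measure
  for continuous configurations, counting measure for discrete ones.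
\<close>

definition config_space :: "'o measure \<Rightarrow> nat \<Rightarrow> (nat \<Rightarrow> 'o) measure" where
  "config_space \<Omega> N = (\<Pi>\<^sub>M i\<in>{..<N}. \<Omega>)"

text \<open>
  In the following \<open>M\<close> is the reference measure on configurations, \<open>H\<close> the Hamiltonian and
  \<open>\<psi>\<close> the family of wavefunctions, with parameter \<open>\<theta>\<close>.
\<close>

definition vmc_density ::
    "'x measure \<Rightarrow> ('t \<Rightarrow> 'x \<Rightarrow> real) \<Rightarrow> 't \<Rightarrow> 'x measure" where
  "vmc_density M \<psi> \<theta> =
     density M (\<lambda>x. ennreal (\<bar>\<psi> \<theta> x\<bar>\<^sup>2 / (\<integral>y. \<bar>\<psi> \<theta> y\<bar>\<^sup>2 \<partial>M)))"

definition local_energy ::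
    "(('x \<Rightarrow> real) \<Rightarrow> ('x \<Rightarrow> real)) \<Rightarrow> ('t \<Rightarrow> 'x \<Rightarrow> real) \<Rightarrow> 't \<Rightarrow> 'x \<Rightarrow> real" where
  "local_energy H \<psi> \<theta> x = H (\<psi> \<theta>) x / \<psi> \<theta> x"

definition energy ::
    "'x measure \<Rightarrow> (('x \<Rightarrow> real) \<Rightarrow> ('x \<Rightarrow> real)) \<Rightarrow> ('t \<Rightarrow> 'x \<Rightarrow> real) \<Rightarrow> 't \<Rightarrow> real" where
  "energy M H \<psi> \<theta> = L2_inner M (\<psi> \<theta>) (H (\<psi> \<theta>)) / L2_inner M (\<psi> \<theta>) (\<psi> \<theta>)"

definition centered_energy ::
    "'x measure \<Rightarrow> (('x \<Rightarrow> real) \<Rightarrow> ('x \<Rightarrow> real)) \<Rightarrow> ('t \<Rightarrow> 'x \<Rightarrow> real) \<Rightarrow> 't \<Rightarrow> 'x \<Rightarrow> real" where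
  "centered_energy M H \<psi> \<theta> x = local_energy H \<psi> \<theta> x - energy M H \<psi> \<theta>"

definition score :: "('t::real_inner \<Rightarrow> 'x \<Rightarrow> real) \<Rightarrow> 't \<Rightarrow> 'x \<Rightarrow> 't" where
  "score \<psi> \<theta> x = gradient (\<lambda>\<theta>'. ln \<bar>\<psi> \<theta>' x\<bar>) \<theta>"

definition centered_score ::
    "'x measure \<Rightarrow> ('t::euclidean_space \<Rightarrow> 'x \<Rightarrow> real) \<Rightarrow> 't \<Rightarrow> 'x \<Rightarrow> 't" where
  "centered_score M \<psi> \<theta> x = score \<psi> \<theta> x - (\<integral>y. score \<psi> \<theta> y \<partial>vmc_density M \<psi> \<theta>)"

definition energy_gradient ::
    "'x measure \<Rightarrow> (('x \<Rightarrow> real) \<Rightarrow> ('x \<Rightarrow> real)) \<Rightarrow> ('t::real_inner \<Rightarrow> 'x \<Rightarrow> real) \<Rightarrow> 't \<Rightarrow> 't" where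
  "energy_gradient M H \<psi> \<theta> = gradient (energy M H \<psi>) \<theta>"

definition outer_product :: "real ^ 'p \<Rightarrow> real ^ 'p \<Rightarrow> real ^ 'p ^ 'p" where
  "outer_product v w = (\<chi> i j. v $ i * w $ j)"

definition SR_matrix ::
    "'x measure \<Rightarrow> (real ^ 'p \<Rightarrow> 'x \<Rightarrow> real) \<Rightarrow> real ^ 'p \<Rightarrow> real ^ 'p ^ 'p" where
  "SR_matrix M \<psi> \<theta> =
     (\<integral>x. outer_product (centered_score M \<psi> \<theta> x) (centered_score M \<psi> \<theta> x) \<partial>vmc_density M \<psi> \<theta>)"

text \<open>
  Standing assumptions. \<open>D\<close> is the domain of the Hamiltonian \<open>H\<close>. The logarithmic derivatives
  are only required to exist almost surely under the sampling density: in particular nothing is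
  required at nodes of the wavefunction, where \<open>ln 0 = 0\<close> and division by zero make \<open>score\<close>
  and \<open>local_energy\<close> meaningless but where the sampling density vanishes.
\<close>

locale vmc_setting =
  fixes \<Omega> :: "'o measure"
    and N :: nat
    and D :: "((nat \<Rightarrow> 'o) \<Rightarrow> real) set"
    and H :: "((nat \<Rightarrow> 'o) \<Rightarrow> real) \<Rightarrow> ((nat \<Rightarrow> 'o) \<Rightarrow> real)"
    and \<psi> :: "real ^ 'p \<Rightarrow> (nat \<Rightarrow> 'o) \<Rightarrow> real"
  assumes sigma_finite: "sigma_finite_measure \<Omega>"
    and self_adjoint: "self_adjoint_operator (config_space \<Omega> N) D H"
    and wavefunction_domain: "\<psi> \<theta> \<in> D"
    and wavefunction_nonzero: "\<not> (AE x in config_space \<Omega> N. \<psi> \<theta> x = 0)"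
    and log_differentiable:
      "AE x in vmc_density (config_space \<Omega> N) \<psi> \<theta>. (\<lambda>\<theta>'. ln \<bar>\<psi> \<theta>' x\<bar>) differentiable (at \<theta>)"
    and score_measurable: "score \<psi> \<theta> \<in> borel_measurable (config_space \<Omega> N)"
    and energy_differentiable: "energy (config_space \<Omega> N) H \<psi> differentiable (at \<theta>)"
    and gradient_identity:
      "energy_gradient (config_space \<Omega> N) H \<psi> \<theta> =
         2 *\<^sub>R (\<integral>x. centered_energy (config_space \<Omega> N) H \<psi> \<theta> x *\<^sub>R
                    centered_score (config_space \<Omega> N) \<psi> \<theta> x
              \<partial>vmc_density (config_space \<Omega> N) \<psi> \<theta>)"

text \<open>
  The full-batch SPRING iteration; \<open>\<Delta>\<^sub>0\<close> plays the role of the update with index \<open>-1\<close>,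
  \<open>\<Delta> k\<close> that of the update with index \<open>k\<close>.
\<close>

definition full_batch_SPRING ::
    "'x measure \<Rightarrow> (('x \<Rightarrow> real) \<Rightarrow> ('x \<Rightarrow> real)) \<Rightarrow> (real ^ 'p \<Rightarrow> 'x \<Rightarrow> real) \<Rightarrow>
     real \<Rightarrow> real \<Rightarrow> (nat \<Rightarrow> real) \<Rightarrow> real ^ 'p \<Rightarrow> real ^ 'p \<Rightarrow>
     (nat \<Rightarrow> real ^ 'p) \<Rightarrow> (nat \<Rightarrow> real ^ 'p) \<Rightarrow> bool" where
  "full_batch_SPRING M H \<psi> lam \<mu> \<eta> \<theta>\<^sub>0 \<Delta>\<^sub>0 \<theta> \<Delta> \<longleftrightarrow>
     \<theta> 0 = \<theta>\<^sub>0 \<and>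
     (\<forall>k. \<Delta> k = matrix_inv (lam *\<^sub>R mat 1 + SR_matrix M \<psi> (\<theta> k)) *v
            ((lam * \<mu>) *\<^sub>R (case k of 0 \<Rightarrow> \<Delta>\<^sub>0 | Suc j \<Rightarrow> \<Delta> j)
               - (1/2) *\<^sub>R energy_gradient M H \<psi> (\<theta> k))) \<and>
     (\<forall>k. \<theta> (Suc k) = \<theta> k + \<eta> k *\<^sub>R \<Delta> k)"

end

theory Submission
  imports Defs
begin

text \<open>
  The function \<open>L \<theta>\<^sub>k + \<lambda> \<mu> \<eta>\<^sub>k \<parallel>\<Delta>\<theta>\<^sub>k\<^sub>-\<^sub>1\<parallel>\<^sup>2\<close> is a Lyapunov function of the iteration. Solving the
  linear system for \<open>g \<theta>\<^sub>k\<close> and inserting it in the descent inequality of the \<open>C\<^sub>g\<close>-smooth energy,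
  the step size condition makes it decrease by at least \<open>\<lambda> (1 - \<mu>) \<eta>\<^sub>k \<parallel>\<Delta>\<theta>\<^sub>k\<parallel>\<^sup>2\<close>. The moment bounds
  make the energy bounded below, so these decrements are summable, and bound the SR matrices
  uniformly, so that \<open>\<parallel>g \<theta>\<^sub>k\<parallel>\<^sup>2\<close> is dominated by \<open>\<parallel>\<Delta>\<theta>\<^sub>k\<^sub>-\<^sub>1\<parallel>\<^sup>2 + \<parallel>\<Delta>\<theta>\<^sub>k\<parallel>\<^sup>2\<close> and
  \<open>\<eta>\<^sub>k \<parallel>g \<theta>\<^sub>k\<parallel>\<^sup>2\<close> is summable too.
\<close>

section \<open>Gradients and the descent inequality of smooth functions\<close>

lemma has_gradient_gradient:
  fixes f :: "'a::euclidean_space \<Rightarrow> real"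
  assumes "f differentiable (at x)"
  shows "GDERIV f x :> gradient f x"
proof -
  obtain f' where f': "(f has_derivative f') (at x)"
    using assms unfolding differentiable_def by blast
  then interpret bounded_linear f' by (rule has_derivative_bounded_linear)
  \<comment> \<open>The Riesz representer of the derivative is read off from its values on the
    basis. Together with the uniqueness shown below, it makes the \<open>THE\<close> in
    \<open>gradient\<close> well defined.\<close>
  have "f' h = h \<bullet> (\<Sum>b\<in>Basis. f' b *\<^sub>R b)" for h
  proof -
    have "f' h = f' (\<Sum>b\<in>Basis. (h \<bullet> b) *\<^sub>R b)" by (simp add: euclidean_representation)
    also have "\<dots> = (\<Sum>b\<in>Basis. (h \<bullet> b) * f' b)" by (simp add: sum scaleR)
    also have "\<dots> = h \<bullet> (\<Sum>b\<in>Basis. f' b *\<^sub>R b)" by (simp add: inner_sum_right mult.commute)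
    finally show ?thesis .
  qed
  then have "f' = (\<lambda>h. h \<bullet> (\<Sum>b\<in>Basis. f' b *\<^sub>R b))" by blast
  then have D: "GDERIV f x :> (\<Sum>b\<in>Basis. f' b *\<^sub>R b)"
    using f' unfolding gderiv_def by metis
  have "E = E'" if "GDERIV f x :> E" "GDERIV f x :> E'" for E E'
  proof -
    have "(\<lambda>h. h \<bullet> E) = (\<lambda>h. h \<bullet> E')"
      using that unfolding gderiv_def by (rule has_derivative_unique)
    then show ?thesis by (simp add: fun_eq_iff vector_eq_ldot)
  qed
  from D this[OF _ D] show ?thesis unfolding gradient_def by (rule theI[where P = "\<lambda>D. GDERIV f x :> D"])
qed

text \<open>Along the segment, the slope of \<open>f\<close> exceeds \<open>g x \<bullet> d\<close>
  by at most \<open>C * t * (norm d)\<^sup>2\<close>. Hence \<open>\<phi>\<close>, which is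
  \<open>f\<close> minus its quadratic upper model, cannot increase, and
  \<open>\<phi> 1 \<le> \<phi> 0\<close> is the claim.\<close>

lemma descent_inequality:
  fixes f :: "'a::real_inner \<Rightarrow> real"
  assumes grad: "\<And>x. GDERIV f x :> g x"
    and Lip: "\<And>x y. norm (g x - g y) \<le> C * norm (x - y)"
  shows "f (x + d) \<le> f x + g x \<bullet> d + C / 2 * (norm d)\<^sup>2"
proof -
  define \<phi> where "\<phi> t = f (x + t *\<^sub>R d) - t * (g x \<bullet> d) - C / 2 * t\<^sup>2 * (norm d)\<^sup>2" for t
  have deriv: "(\<phi> has_real_derivative g (x + t *\<^sub>R d) \<bullet> d - g x \<bullet> d - C * t * (norm d)\<^sup>2) (at t)" for t
  proof -
    have "((\<lambda>t. f (x + t *\<^sub>R d)) has_derivative (\<lambda>h. (h *\<^sub>R d) \<bullet> g (x + t *\<^sub>R d))) (at t)"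
      by (rule has_derivative_compose[where g = f])
        (auto intro!: derivative_eq_intros grad[unfolded gderiv_def])
    then have "((\<lambda>t. f (x + t *\<^sub>R d)) has_real_derivative g (x + t *\<^sub>R d) \<bullet> d) (at t)"
      unfolding has_field_derivative_def
      by (rule has_derivative_eq_rhs) (simp add: inner_commute mult.commute fun_eq_iff)
    then show ?thesis
      unfolding \<phi>_def by (auto intro!: derivative_eq_intros)
  qed
  have "\<phi> 1 \<le> \<phi> 0"
  proof (rule DERIV_nonpos_imp_nonincreasing[of 0 1])
    fix t :: real assume t: "0 \<le> t" "t \<le> 1"
    have "g (x + t *\<^sub>R d) \<bullet> d - g x \<bullet> d \<le> norm (g (x + t *\<^sub>R d) - g x) * norm d"
      by (simp add: inner_diff_left[symmetric] norm_cauchy_schwarz)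
    also have "\<dots> \<le> C * norm (t *\<^sub>R d) * norm d"
      using Lip[of "x + t *\<^sub>R d" x] by (intro mult_right_mono) auto
    also have "\<dots> = C * t * (norm d)\<^sup>2"
      using t by (simp add: power2_eq_square)
    finally show "\<exists>y. (\<phi> has_real_derivative y) (at t) \<and> y \<le> 0"
      using deriv[of t] by (intro exI conjI) auto
  qed simp
  then show ?thesis by (simp add: \<phi>_def)
qed

section \<open>The Lyapunov estimate for the abstract recursion\<close>

text \<open>Deterministic core of the convergence proof, with \<open>A k\<close> in the role of the
  SR matrix: its nonnegativity yields descent, and its bound \<open>B\<close> turns control of the
  steps into control of the gradients. \<open>direction\<close> is the update with the inverse
  cleared; \<open>prev\<close> is \<open>\<Delta>\<close> delayed by one index, so
  \<open>prev 0\<close> can hold the initial vector.\<close>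

lemma spring_summable:
  fixes L :: "'a::real_inner \<Rightarrow> real" and g :: "'a \<Rightarrow> 'a" and A :: "nat \<Rightarrow> 'a \<Rightarrow> 'a"
    and \<theta> \<Delta> prev :: "nat \<Rightarrow> 'a" and \<eta> :: "nat \<Rightarrow> real"
  assumes grad: "\<And>x. GDERIV L x :> g x"
    and Lip: "\<And>x y. norm (g x - g y) \<le> C * norm (x - y)"
    and below: "\<And>x. m \<le> L x"
    and C: "0 < C" and lam: "0 < lam" and mu: "0 \<le> \<mu>" "\<mu> < 1"
    and eta: "\<And>k. 0 < \<eta> k" "\<And>k. \<eta> (Suc k) \<le> \<eta> k" "\<eta> 0 \<le> 2 * lam * (1 - \<mu>) / C"
    and A_nonneg: "\<And>k x. 0 \<le> A k x \<bullet> x"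
    and A_bound: "\<And>k x. norm (A k x) \<le> B * norm x"
    and prev: "\<And>k. prev (Suc k) = \<Delta> k"
    and direction: "\<And>k. lam *\<^sub>R \<Delta> k + A k (\<Delta> k) = (lam * \<mu>) *\<^sub>R prev k - (1/2) *\<^sub>R g (\<theta> k)"
    and step: "\<And>k. \<theta> (Suc k) = \<theta> k + \<eta> k *\<^sub>R \<Delta> k"
  shows "summable (\<lambda>k. \<eta> k * (norm (g (\<theta> k)))\<^sup>2)"
proof -
  define V where "V k = L (\<theta> k) + lam * \<mu> * \<eta> k * (norm (prev k))\<^sup>2" for k
  define a where "a k = \<eta> k * (norm (\<Delta> k))\<^sup>2" for k
  have g_eq: "g (\<theta> k) = (2 * lam * \<mu>) *\<^sub>R prev k - (2 * lam) *\<^sub>R \<Delta> k - 2 *\<^sub>R A k (\<Delta> k)" for k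
  proof -
    have "g (\<theta> k) = 2 *\<^sub>R ((lam * \<mu>) *\<^sub>R prev k - (lam *\<^sub>R \<Delta> k + A k (\<Delta> k)))"
      unfolding direction by simp
    then show ?thesis by (simp add: algebra_simps)
  qed
  have eta_le: "C * \<eta> k \<le> 2 * lam * (1 - \<mu>)" for k
  proof -
    have "\<eta> k \<le> \<eta> 0" by (induction k) (auto intro: order_trans eta(2))
    then have "\<eta> k \<le> 2 * lam * (1 - \<mu>) / C" using eta(3) by linarith
    then show ?thesis using C by (simp add: field_simps)
  qed
  have a_nonneg: "0 \<le> a k" for k using eta(1)[of k] by (simp add: a_def)
  have descent: "V (Suc k) \<le> V k - lam * (1 - \<mu>) * a k" for k
  proof -
    let ?d = "\<Delta> k" and ?p = "prev k"
    \<comment> \<open>Young's inequality splits the cross term between momentum and new step evenly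
      between the two squares.\<close>
    have "0 \<le> (norm (?p - ?d))\<^sup>2" by simp
    then have pd: "2 * (?p \<bullet> ?d) \<le> (norm ?p)\<^sup>2 + (norm ?d)\<^sup>2"
      by (simp add: power2_norm_eq_inner inner_diff_left inner_diff_right inner_commute)
    have "g (\<theta> k) \<bullet> ?d = lam * \<mu> * (2 * (?p \<bullet> ?d)) - 2 * lam * (norm ?d)\<^sup>2 - 2 * (A k ?d \<bullet> ?d)"
      by (simp add: g_eq inner_diff_left power2_norm_eq_inner)
    \<comment> \<open>The term with \<open>A k\<close> has the favourable sign and is
      dropped.\<close>
    also have "\<dots> \<le> lam * \<mu> * ((norm ?p)\<^sup>2 + (norm ?d)\<^sup>2) - 2 * lam * (norm ?d)\<^sup>2"
    proof -
      have "lam * \<mu> * (2 * (?p \<bullet> ?d)) \<le> lam * \<mu> * ((norm ?p)\<^sup>2 + (norm ?d)\<^sup>2)"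
        using lam mu by (intro mult_left_mono[OF pd]) simp
      then show ?thesis using A_nonneg[of k ?d] by linarith
    qed
    finally have gd: "g (\<theta> k) \<bullet> ?d \<le> lam * \<mu> * (norm ?p)\<^sup>2 - lam * (2 - \<mu>) * (norm ?d)\<^sup>2"
      by (simp add: algebra_simps)
    \<comment> \<open>The step size condition enters here: it absorbs the second-order error into
      \<open>lam * (1 - \<mu>)\<close>.\<close>
    have "C / 2 * (norm (\<eta> k *\<^sub>R ?d))\<^sup>2 = \<eta> k * (C * \<eta> k / 2 * (norm ?d)\<^sup>2)"
      by (simp add: power2_eq_square)
    also have "\<dots> \<le> \<eta> k * (lam * (1 - \<mu>) * (norm ?d)\<^sup>2)"
      using eta_le[of k] eta(1)[of k] by (intro mult_left_mono mult_right_mono) auto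
    finally have quad: "C / 2 * (norm (\<eta> k *\<^sub>R ?d))\<^sup>2 \<le> \<eta> k * (lam * (1 - \<mu>) * (norm ?d)\<^sup>2)" .
    have "L (\<theta> (Suc k)) \<le> L (\<theta> k) + \<eta> k * (g (\<theta> k) \<bullet> ?d) + C / 2 * (norm (\<eta> k *\<^sub>R ?d))\<^sup>2"
      using descent_inequality[OF grad Lip, of "\<theta> k" "\<eta> k *\<^sub>R ?d"] by (simp add: step)
    also have "\<dots> \<le> L (\<theta> k) + \<eta> k * (lam * \<mu> * (norm ?p)\<^sup>2 - lam * (2 - \<mu>) * (norm ?d)\<^sup>2)
        + \<eta> k * (lam * (1 - \<mu>) * (norm ?d)\<^sup>2)"
      using mult_left_mono[OF gd, of "\<eta> k"] eta(1)[of k] quad by linarith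
    \<comment> \<open>The coefficients combine as (2 - \<mu>) - (1 - \<mu>) = 1, and the momentum
      term completes \<open>L (\<theta> k)\<close> to \<open>V k\<close>.\<close>
    also have "\<dots> = V k - lam * a k"
      by (simp add: V_def a_def algebra_simps)
    finally have "L (\<theta> (Suc k)) \<le> V k - lam * a k" .
    \<comment> \<open>The momentum term of \<open>V (Suc k)\<close> takes back at most
      \<open>lam * \<mu> * a k\<close> because the step sizes do not increase;
      \<open>lam * (1 - \<mu>) * a k\<close> remains.\<close>
    moreover have "lam * \<mu> * (\<eta> (Suc k) * (norm ?d)\<^sup>2) \<le> lam * \<mu> * a k"
      using eta(2)[of k] lam mu unfolding a_def
      by (intro mult_left_mono mult_right_mono) auto
    ultimately show ?thesis by (simp add: V_def prev algebra_simps)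
  qed
  have V_below: "m \<le> V k" for k
    using below[of "\<theta> k"] eta(1)[of k] lam mu by (simp add: V_def add_increasing2)
  have sum_le: "lam * (1 - \<mu>) * (\<Sum>k<n. a k) \<le> V 0 - V n" for n
  proof (induction n)
    case (Suc n)
    then show ?case using descent[of n] by (simp add: distrib_left)
  qed simp
  have "summable a"
  proof (rule summableI_nonneg_bounded[OF a_nonneg])
    fix n
    have "lam * (1 - \<mu>) * (\<Sum>k<n. a k) \<le> V 0 - m" using sum_le[of n] V_below[of n] by linarith
    then show "(\<Sum>k<n. a k) \<le> (V 0 - m) / (lam * (1 - \<mu>))"
      using lam mu by (simp add: pos_le_divide_eq mult.commute)
  qed
  \<comment> \<open>Dropping the term with the initial vector leaves the shifted sequence, which
    \<open>a\<close> dominates by monotonicity of the step sizes.\<close>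
  have "summable (\<lambda>k. \<eta> k * (norm (prev k))\<^sup>2)"
  proof (rule summable_Suc_iff[THEN iffD1], rule summable_comparison_test'[OF \<open>summable a\<close>])
    show "norm (\<eta> (Suc k) * (norm (prev (Suc k)))\<^sup>2) \<le> a k" for k
      using eta(1)[of "Suc k"] eta(2)[of k] by (auto simp: a_def prev abs_mult intro: mult_right_mono)
  qed
  \<comment> \<open>The factor is 12 = 4 * 3: the square of the 2 in \<open>g_eq\<close>, times 3
    for the square of a sum of three terms.\<close>
  define c where "c = 12 * (lam\<^sup>2 * \<mu>\<^sup>2)"
  define c' where "c' = 12 * (lam\<^sup>2 + B\<^sup>2)"
  have g_bound: "(norm (g (\<theta> k)))\<^sup>2 \<le> c * (norm (prev k))\<^sup>2 + c' * (norm (\<Delta> k))\<^sup>2" for k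
  proof -
    define u v w where "u = lam * \<mu> * norm (prev k)" and "v = lam * norm (\<Delta> k)"
      and "w = norm (A k (\<Delta> k))"
    have "norm (g (\<theta> k)) \<le> norm ((2 * lam * \<mu>) *\<^sub>R prev k) + norm ((2 * lam) *\<^sub>R \<Delta> k)
        + norm (2 *\<^sub>R A k (\<Delta> k))"
      unfolding g_eq by (meson add_mono norm_triangle_ineq4 order_refl order_trans)
    also have "\<dots> = 2 * (u + v + w)"
      using lam mu by (simp add: u_def v_def w_def abs_mult)
    finally have "(norm (g (\<theta> k)))\<^sup>2 \<le> (2 * (u + v + w))\<^sup>2" by (rule power_mono) simp
    \<comment> \<open>Adding the squares of the three pairwise differences gives (u + v + w)^2 \<le>
      3 (u^2 + v^2 + w^2).\<close>
    also have "\<dots> \<le> 12 * (u\<^sup>2 + v\<^sup>2 + w\<^sup>2)"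
      using sum_squares_ge_zero[of "u - v" "v - w"] zero_le_power2[of "u - w"]
      by (simp add: power2_eq_square algebra_simps)
    also have "w\<^sup>2 \<le> B\<^sup>2 * (norm (\<Delta> k))\<^sup>2"
      using A_bound[of k "\<Delta> k"] unfolding w_def
      by (metis norm_ge_zero power_mono power_mult_distrib)
    finally show ?thesis
      by (simp add: c_def c'_def u_def v_def power_mult_distrib algebra_simps)
  qed
  show ?thesis
  proof (rule summable_comparison_test')
    show "summable (\<lambda>k. c * (\<eta> k * (norm (prev k))\<^sup>2) + c' * a k)"
      by (intro summable_add summable_mult) fact+
    show "norm (\<eta> k * (norm (g (\<theta> k)))\<^sup>2) \<le> c * (\<eta> k * (norm (prev k))\<^sup>2) + c' * a k" for k
      using mult_left_mono[OF g_bound[of k], of "\<eta> k"] eta(1)[of k]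
      by (simp add: a_def abs_mult algebra_simps)
  qed
qed

section \<open>Consequences of weighted summability\<close>

text \<open>A minimum is at most the weighted average, whose numerator is bounded by the whole
  series; that series is the O-constant.\<close>

lemma Min_bigo_of_summable_weighted:
  fixes \<eta> b :: "nat \<Rightarrow> real"
  assumes eta: "\<And>k. 0 < \<eta> k" and b: "\<And>k. 0 \<le> b k" and sm: "summable (\<lambda>k. \<eta> k * b k)"
  shows "(\<lambda>K. Min (b ` {1..K})) \<in> O(\<lambda>K. 1 / (\<Sum>k=1..K. \<eta> k))"
proof (rule bigoI[where c = "\<Sum>k. \<eta> k * b k"])
  \<comment> \<open>\<open>K = 0\<close> is left out, since \<open>Min\<close> of the empty set is
    unspecified; the bound only has to hold eventually.\<close>
  have "norm (Min (b ` {1..K})) \<le> (\<Sum>k. \<eta> k * b k) * norm (1 / (\<Sum>k=1..K. \<eta> k))" if K: "1 \<le> K" for K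
  proof -
    have pos: "0 < (\<Sum>k=1..K. \<eta> k)" using K eta by (intro sum_pos) auto
    have Min_nonneg: "0 \<le> Min (b ` {1..K})" using K b by (subst Min_ge_iff) auto
    have "Min (b ` {1..K}) * (\<Sum>k=1..K. \<eta> k) = (\<Sum>k=1..K. \<eta> k * Min (b ` {1..K}))"
      unfolding sum_distrib_right[symmetric] by (rule mult.commute)
    also have "\<dots> \<le> (\<Sum>k=1..K. \<eta> k * b k)"
      using eta by (intro sum_mono mult_left_mono) (auto intro: less_imp_le)
    also have "\<dots> \<le> (\<Sum>k. \<eta> k * b k)"
      using eta b by (intro sum_le_suminf sm) (auto intro: mult_nonneg_nonneg less_imp_le)
    finally show ?thesis using pos Min_nonneg by (simp add: field_simps)
  qed
  then show "\<forall>\<^sub>F K in sequentially. norm (Min (b ` {1..K})) \<le> (\<Sum>k. \<eta> k * b k) * norm (1 / (\<Sum>k=1..K. \<eta> k))"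
    by (auto simp: eventually_sequentially)
qed

text \<open>If the liminf were positive, \<open>r\<close> would eventually exceed some
  \<open>e > 0\<close>; comparison would then make \<open>\<eta>\<close> itself summable, against
  the divergence of its partial sums.\<close>

lemma liminf_zero_of_summable_weighted:
  fixes \<eta> r :: "nat \<Rightarrow> real"
  assumes eta: "\<And>k. 0 < \<eta> k" and r: "\<And>k. 0 \<le> r k" and sm: "summable (\<lambda>k. \<eta> k * (r k)\<^sup>2)"
    and div: "filterlim (\<lambda>n. \<Sum>k<n. \<eta> k) at_top sequentially"
  shows "liminf (\<lambda>k. ereal (r k)) = 0"
proof (rule antisym)
  show "0 \<le> liminf (\<lambda>k. ereal (r k))" by (intro Liminf_bounded) (simp add: r)
  show "liminf (\<lambda>k. ereal (r k)) \<le> 0"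
  proof (rule ccontr)
    assume "\<not> ?thesis"
    then have "0 < liminf (\<lambda>k. ereal (r k))" by simp
    then obtain e where e: "0 < ereal e" "ereal e < liminf (\<lambda>k. ereal (r k))"
      using ereal_dense2 by blast
    then have "\<forall>\<^sub>F k in sequentially. e < r k"
      using less_LiminfD[OF e(2)] by simp
    then obtain n0 where n0: "\<And>k. n0 \<le> k \<Longrightarrow> e < r k" by (auto simp: eventually_sequentially)
    have "summable (\<lambda>k. \<eta> k * e\<^sup>2)"
    proof (rule summable_comparison_test'[OF sm])
      fix k assume "n0 \<le> k"
      then show "norm (\<eta> k * e\<^sup>2) \<le> \<eta> k * (r k)\<^sup>2"
        using n0[of k] e(1) eta[of k] by (simp add: abs_mult power_mono)
    qed
    then have "summable (\<lambda>k. \<eta> k * e\<^sup>2 * (1 / e\<^sup>2))" by (rule summable_mult2)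
    then have "summable \<eta>" using e(1) by simp
    then have "(\<lambda>n. \<Sum>k<n. \<eta> k) \<longlonglongrightarrow> suminf \<eta>" by (simp add: summable_LIMSEQ)
    moreover have "filterlim (\<lambda>n. \<Sum>k<n. \<eta> k) at_infinity sequentially"
      using div by (rule filterlim_at_top_imp_at_infinity)
    ultimately show False
      using not_tendsto_and_filterlim_at_infinity[OF sequentially_bot] by blast
  qed
qed

section \<open>Moments and outer products\<close>

text \<open>On a probability space this follows by integrating a^n \<le> 1 + a^4. The hypothesis
  uses the nonnegative integral so that finiteness is part of it; a Bochner integral would be 0 for
  a non-integrable function.\<close>

lemma (in prob_space) moment_le_of_fourth_moment:
  fixes f :: "'a \<Rightarrow> 'b::{banach, second_countable_topology}"
  assumes [measurable]: "f \<in> borel_measurable M"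
    and fourth: "(\<integral>\<^sup>+x. ennreal (norm (f x) ^ 4) \<partial>M) \<le> ennreal C" and C: "0 \<le> C" and n: "n \<le> 4"
  shows "integrable M (\<lambda>x. norm (f x) ^ n)" and "(\<integral>x. norm (f x) ^ n \<partial>M) \<le> 1 + C"
proof -
  have "(\<integral>\<^sup>+x. ennreal (norm (f x) ^ 4) \<partial>M) < \<infinity>"
    using fourth by (simp add: order_le_less_trans)
  then have int4: "integrable M (\<lambda>x. norm (f x) ^ 4)"
    by (intro integrableI_bounded) auto
  then have "ennreal (\<integral>x. norm (f x) ^ 4 \<partial>M) \<le> ennreal C"
    using fourth by (subst nn_integral_eq_integral[symmetric]) auto
  then have le4: "(\<integral>x. norm (f x) ^ 4 \<partial>M) \<le> C" using C by simp
  have le: "a ^ n \<le> 1 + a ^ 4" if "0 \<le> a" for a :: real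
  proof (cases "a \<le> 1")
    case True
    then have "a ^ n \<le> 1" using that by (simp add: power_le_one)
    then show ?thesis using that by (simp add: add_increasing2)
  next
    case False
    then have "a ^ n \<le> a ^ 4" using n by (intro power_increasing) auto
    then show ?thesis by simp
  qed
  show int: "integrable M (\<lambda>x. norm (f x) ^ n)"
    by (rule Bochner_Integration.integrable_bound[of M "\<lambda>x. 1 + norm (f x) ^ 4"]) (auto simp: int4 le)
  have "(\<integral>x. norm (f x) ^ n \<partial>M) \<le> (\<integral>x. 1 + norm (f x) ^ 4 \<partial>M)"
    using int int4 by (intro integral_mono) (auto simp: le)
  also have "\<dots> \<le> 1 + C" using int4 le4 by (simp add: prob_space)
  finally show "(\<integral>x. norm (f x) ^ n \<partial>M) \<le> 1 + C" .
qed

lemma outer_product_mult_vector: "outer_product v w *v x = (w \<bullet> x) *\<^sub>R v"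
  by (simp add: outer_product_def vec_eq_iff matrix_vector_mult_def inner_vec_def
      sum_distrib_left mult_ac)

text \<open>The norm of a nested vector is the Frobenius norm, and row \<open>i\<close> is
  \<open>w\<close> scaled by \<open>v $ i\<close>.\<close>

lemma norm_outer_product_le: "norm (outer_product v w) \<le> norm v * norm w"
proof -
  have "norm (outer_product v w $ i) = \<bar>v $ i\<bar> * norm w" for i
  proof -
    have "outer_product v w $ i = (v $ i) *\<^sub>R w" by (simp add: outer_product_def vec_eq_iff)
    then show ?thesis by simp
  qed
  then show ?thesis
    by (simp add: norm_vec_def[of "outer_product v w"] norm_vec_def[of v] L2_set_left_distrib)
qed

section \<open>Sampling density, energy and SR matrix\<close>

context vmc_setting
begin

abbreviation M where "M \<equiv> config_space \<Omega> N"
abbreviation \<pi> where "\<pi> t \<equiv> vmc_density M \<psi> t"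

lemma wavefunction_L2: "\<psi> t \<in> L2_funs M" "H (\<psi> t) \<in> L2_funs M"
  using self_adjoint wavefunction_domain[of t] unfolding self_adjoint_operator_def by auto

lemma wavefunction_measurable [measurable]:
  "\<psi> t \<in> borel_measurable M" "H (\<psi> t) \<in> borel_measurable M"
  using wavefunction_L2[of t] by (auto simp: L2_funs_def)

lemma sampling_prob_space: "prob_space (\<pi> t)"
proof
  let ?Z = "\<integral>x. \<bar>\<psi> t x\<bar>\<^sup>2 \<partial>M"
  have int: "integrable M (\<lambda>x. \<bar>\<psi> t x\<bar>\<^sup>2)" using wavefunction_L2(1)[of t] by (simp add: L2_funs_def)
  \<comment> \<open>A nonnegative integrand with zero integral vanishes almost everywhere, which
    \<open>wavefunction_nonzero\<close> forbids.\<close>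
  have "?Z \<noteq> 0"
    using wavefunction_nonzero[of t] integral_nonneg_eq_0_iff_AE[OF int] by simp
  then have Z: "0 < ?Z" by (simp add: order_less_le)
  have "emeasure (\<pi> t) (space (\<pi> t)) = (\<integral>\<^sup>+x. ennreal (\<bar>\<psi> t x\<bar>\<^sup>2 / ?Z) \<partial>M)"
    by (simp add: vmc_density_def emeasure_density cong: nn_integral_cong)
  also have "\<dots> = ennreal (\<integral>x. \<bar>\<psi> t x\<bar>\<^sup>2 / ?Z \<partial>M)"
    using int Z by (intro nn_integral_eq_integral) auto
  also have "\<dots> = 1" using Z by simp
  finally show "emeasure (\<pi> t) (space (\<pi> t)) = 1" .
qed

lemma energy_eq_expectation: "energy M H \<psi> t = (\<integral>x. local_energy H \<psi> t x \<partial>\<pi> t)"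
proof -
  let ?Z = "\<integral>x. \<bar>\<psi> t x\<bar>\<^sup>2 \<partial>M"
  have "(\<integral>x. local_energy H \<psi> t x \<partial>\<pi> t) = (\<integral>x. (\<bar>\<psi> t x\<bar>\<^sup>2 / ?Z) *\<^sub>R local_energy H \<psi> t x \<partial>M)"
    unfolding vmc_density_def local_energy_def by (intro integral_density) auto
  \<comment> \<open>One factor \<open>\<psi> t x\<close> cancels the denominator of the local
    energy; at nodes both integrands are 0.\<close>
  also have "\<dots> = (\<integral>x. \<psi> t x * H (\<psi> t) x / ?Z \<partial>M)"
    by (intro Bochner_Integration.integral_cong) (auto simp: local_energy_def power2_eq_square)
  also have "\<dots> = energy M H \<psi> t"
    by (simp add: energy_def L2_inner_def power2_eq_square)
  finally show ?thesis by simp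
qed

text \<open>The energy is a mean of local energies, so their first absolute moment bounds it. This
  supplies the lower bound of the Lyapunov function.\<close>

lemma energy_bounded_below:
  assumes "(\<integral>\<^sup>+x. ennreal (local_energy H \<psi> t x ^ 4) \<partial>\<pi> t) \<le> ennreal C" "0 \<le> C"
  shows "- (1 + C) \<le> energy M H \<psi> t"
proof -
  interpret P: prob_space "\<pi> t" by (rule sampling_prob_space)
  have meas: "local_energy H \<psi> t \<in> borel_measurable (\<pi> t)"
    unfolding vmc_density_def local_energy_def[abs_def] by simp
  have "norm (energy M H \<psi> t) \<le> (\<integral>x. norm (local_energy H \<psi> t x) \<partial>\<pi> t)"
    unfolding energy_eq_expectation by (rule integral_norm_bound)
  also have "\<dots> \<le> 1 + C"
    using P.moment_le_of_fourth_moment(2)[OF meas, of C 1] assms by simp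
  finally show ?thesis by simp
qed

context
  fixes t C
  assumes score_moment: "(\<integral>\<^sup>+x. ennreal (norm (score \<psi> t x) ^ 4) \<partial>\<pi> t) \<le> ennreal C"
    and C: "0 \<le> C"
begin

lemma centered_score_measurable: "centered_score M \<psi> t \<in> borel_measurable (\<pi> t)"
  using score_measurable[of t] unfolding centered_score_def[abs_def] vmc_density_def by simp

text \<open>The integral is the trace of the SR matrix. In its bound, \<open>2 * (1 + C)\<close>
  comes from the second moment of the score and \<open>2 * (1 + C)\<^sup>2\<close> from its squared
  mean.\<close>

lemma centered_score_second_moment:
  "integrable (\<pi> t) (\<lambda>x. (norm (centered_score M \<psi> t x))\<^sup>2)"
  "(\<integral>x. (norm (centered_score M \<psi> t x))\<^sup>2 \<partial>\<pi> t) \<le> 2 * (1 + C) + 2 * (1 + C)\<^sup>2"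
proof -
  interpret P: prob_space "\<pi> t" by (rule sampling_prob_space)
  have meas: "score \<psi> t \<in> borel_measurable (\<pi> t)"
    using score_measurable[of t] by (simp add: vmc_density_def)
  note moment = P.moment_le_of_fourth_moment[OF meas score_moment C]
  define m where "m = (\<integral>x. score \<psi> t x \<partial>\<pi> t)"
  have "norm m \<le> (\<integral>x. norm (score \<psi> t x) \<partial>\<pi> t)"
    unfolding m_def by (rule integral_norm_bound)
  also have "\<dots> \<le> 1 + C" using moment(2)[of 1] by simp
  finally have m: "(norm m)\<^sup>2 \<le> (1 + C)\<^sup>2" by (rule power_mono) simp
  have le: "(norm (centered_score M \<psi> t x))\<^sup>2 \<le> 2 * (norm (score \<psi> t x))\<^sup>2 + 2 * (norm m)\<^sup>2" for x
  proof -
    \<comment> \<open>Parallelogram law; the square of the sum is then discarded.\<close>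
    have "(norm (score \<psi> t x - m))\<^sup>2 + (norm (score \<psi> t x + m))\<^sup>2
        = 2 * (norm (score \<psi> t x))\<^sup>2 + 2 * (norm m)\<^sup>2"
      by (simp add: power2_norm_eq_inner inner_diff_left inner_diff_right inner_add_left
          inner_add_right inner_commute)
    then show ?thesis
      using zero_le_power2[of "norm (score \<psi> t x + m)"]
      unfolding centered_score_def m_def by linarith
  qed
  have int2: "integrable (\<pi> t) (\<lambda>x. (norm (score \<psi> t x))\<^sup>2)" by (rule moment(1)) simp
  note [measurable] = centered_score_measurable
  show int: "integrable (\<pi> t) (\<lambda>x. (norm (centered_score M \<psi> t x))\<^sup>2)"
    by (rule Bochner_Integration.integrable_bound
        [of _ "\<lambda>x. 2 * (norm (score \<psi> t x))\<^sup>2 + 2 * (norm m)\<^sup>2"])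
      (auto simp: int2 intro: order_trans[OF le])
  have "(\<integral>x. (norm (centered_score M \<psi> t x))\<^sup>2 \<partial>\<pi> t)
      \<le> (\<integral>x. 2 * (norm (score \<psi> t x))\<^sup>2 + 2 * (norm m)\<^sup>2 \<partial>\<pi> t)"
    using int int2 by (intro integral_mono) (auto simp: le)
  also have "\<dots> \<le> 2 * (1 + C) + 2 * (1 + C)\<^sup>2"
    using int2 moment(2)[of 2] m by (simp add: P.prob_space)
  finally show "(\<integral>x. (norm (centered_score M \<psi> t x))\<^sup>2 \<partial>\<pi> t) \<le> 2 * (1 + C) + 2 * (1 + C)\<^sup>2" .
qed

text \<open>The bounded linear functional \<open>(A *v v) \<bullet> w\<close> of \<open>A\<close>
  commutes with the matrix-valued integral, which exists because the squared norm of the centered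
  score dominates its integrand.\<close>

lemma SR_matrix_inner:
  shows "integrable (\<pi> t) (\<lambda>x. (centered_score M \<psi> t x \<bullet> v) * (centered_score M \<psi> t x \<bullet> w))"
    and "(SR_matrix M \<psi> t *v v) \<bullet> w
      = (\<integral>x. (centered_score M \<psi> t x \<bullet> v) * (centered_score M \<psi> t x \<bullet> w) \<partial>\<pi> t)"
proof -
  note [measurable] = centered_score_measurable
  have "continuous_on UNIV (\<lambda>v::real^'p. outer_product v v)"
    unfolding outer_product_def by (intro continuous_intros)
  then have [measurable]: "(\<lambda>v::real^'p. outer_product v v) \<in> borel_measurable borel"
    by (rule borel_measurable_continuous_onI)
  have int: "integrable (\<pi> t) (\<lambda>x. outer_product (centered_score M \<psi> t x) (centered_score M \<psi> t x))"
    by (rule Bochner_Integration.integrable_bound[OF centered_score_second_moment(1)])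
      (auto simp: power2_eq_square intro: order_trans[OF norm_outer_product_le])
  have "linear (\<lambda>A::real^'p^'p. (A *v v) \<bullet> w)"
    by (intro linearI) (simp_all add: matrix_vector_mult_add_rdistrib inner_add_left
        scaleR_matrix_vector_assoc[symmetric])
  then have bl: "bounded_linear (\<lambda>A::real^'p^'p. (A *v v) \<bullet> w)"
    by (simp add: linear_conv_bounded_linear)
  have eq: "(outer_product O' O' *v v) \<bullet> w = (O' \<bullet> v) * (O' \<bullet> w)" for O' :: "real^'p"
    by (simp add: outer_product_mult_vector)
  show "integrable (\<pi> t) (\<lambda>x. (centered_score M \<psi> t x \<bullet> v) * (centered_score M \<psi> t x \<bullet> w))"
    using integrable_bounded_linear[OF bl int] by (simp add: eq)
  show "(SR_matrix M \<psi> t *v v) \<bullet> w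
      = (\<integral>x. (centered_score M \<psi> t x \<bullet> v) * (centered_score M \<psi> t x \<bullet> w) \<partial>\<pi> t)"
    using integral_bounded_linear[OF bl int] by (simp add: eq SR_matrix_def)
qed

lemma SR_matrix_nonneg: "0 \<le> (SR_matrix M \<psi> t *v v) \<bullet> v"
  unfolding SR_matrix_inner(2) by (rule Bochner_Integration.integral_nonneg) simp

text \<open>Testing the bilinear form against the image \<open>?w\<close> itself gives its squared
  norm; Cauchy-Schwarz inside the expectation leaves one factor \<open>norm ?w\<close> to
  cancel.\<close>

lemma SR_matrix_bounded:
  "norm (SR_matrix M \<psi> t *v v) \<le> (2 * (1 + C) + 2 * (1 + C)\<^sup>2) * norm v"
proof -
  let ?w = "SR_matrix M \<psi> t *v v" and ?O = "centered_score M \<psi> t"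
  have "norm ?w * norm ?w = (\<integral>x. (?O x \<bullet> v) * (?O x \<bullet> ?w) \<partial>\<pi> t)"
    unfolding SR_matrix_inner(2)[symmetric] by (simp add: norm_eq_sqrt_inner)
  also have "\<dots> \<le> (\<integral>x. (norm (?O x))\<^sup>2 * (norm v * norm ?w) \<partial>\<pi> t)"
  proof (rule integral_mono)
    fix x
    have "(?O x \<bullet> v) * (?O x \<bullet> ?w) \<le> \<bar>?O x \<bullet> v\<bar> * \<bar>?O x \<bullet> ?w\<bar>"
      by (simp add: abs_mult[symmetric])
    also have "\<dots> \<le> (norm (?O x) * norm v) * (norm (?O x) * norm ?w)"
      by (intro mult_mono Cauchy_Schwarz_ineq2) auto
    finally show "(?O x \<bullet> v) * (?O x \<bullet> ?w) \<le> (norm (?O x))\<^sup>2 * (norm v * norm ?w)"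
      by (simp add: power2_eq_square mult_ac)
  qed (simp_all add: SR_matrix_inner(1) centered_score_second_moment(1))
  also have "\<dots> = (\<integral>x. (norm (?O x))\<^sup>2 \<partial>\<pi> t) * (norm v * norm ?w)" by simp
  also have "\<dots> \<le> (2 * (1 + C) + 2 * (1 + C)\<^sup>2) * (norm v * norm ?w)"
    by (intro mult_right_mono centered_score_second_moment(2)) simp
  finally have "norm ?w * norm ?w \<le> (2 * (1 + C) + 2 * (1 + C)\<^sup>2) * norm v * norm ?w"
    by (simp add: mult.assoc)
  then show ?thesis
    using C by (cases "norm ?w = 0") (auto simp: mult_le_cancel_right)
qed

end

end

section \<open>The regularized linear system\<close>

text \<open>The form of the sum is at least \<open>c * (v \<bullet> v)\<close>, so the kernel is
  trivial, which suffices for a square matrix.\<close>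

lemma invertible_regularized:
  fixes A :: "real ^ 'n ^ 'n"
  assumes "\<And>v. 0 \<le> (A *v v) \<bullet> v" and "0 < c"
  shows "invertible (c *\<^sub>R mat 1 + A)"
proof -
  have "v = 0" if "(c *\<^sub>R mat 1 + A) *v v = 0" for v
  proof -
    have "c * (v \<bullet> v) + (A *v v) \<bullet> v = ((c *\<^sub>R mat 1 + A) *v v) \<bullet> v"
      by (simp add: matrix_vector_mult_add_rdistrib inner_add_left scaleR_matrix_vector_assoc[symmetric])
    then have "c * (v \<bullet> v) \<le> 0" using that assms(1)[of v] by simp
    then have "v \<bullet> v \<le> 0" using assms(2) by (simp add: mult_le_0_iff)
    then show ?thesis by (metis inner_eq_zero_iff inner_ge_zero order_antisym)
  qed
  then show ?thesis
    unfolding invertible_left_inverse matrix_left_invertible_ker by blast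
qed

lemma mult_matrix_inv:
  assumes "invertible A"
  shows "A ** matrix_inv A = mat 1"
  using assms someI_ex[of "\<lambda>A'. A ** A' = mat 1 \<and> A' ** A = mat 1"]
  unfolding invertible_def matrix_inv_def by blast

section \<open>Instantiation and conclusions\<close>

theorem corollary3p1:
  fixes \<Omega> :: "'o measure"
    and N :: nat
    and D :: "((nat \<Rightarrow> 'o) \<Rightarrow> real) set"
    and H :: "((nat \<Rightarrow> 'o) \<Rightarrow> real) \<Rightarrow> ((nat \<Rightarrow> 'o) \<Rightarrow> real)"
    and \<psi> :: "real ^ 'p \<Rightarrow> (nat \<Rightarrow> 'o) \<Rightarrow> real"
    and lam \<mu> C\<^sub>m C\<^sub>g :: real
    and \<eta> :: "nat \<Rightarrow> real"
    and \<theta>\<^sub>0 \<Delta>\<^sub>0 :: "real ^ 'p"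
    and \<theta> \<Delta> :: "nat \<Rightarrow> real ^ 'p"
  defines "M \<equiv> config_space \<Omega> N"
  defines "g \<equiv> energy_gradient M H \<psi>"
  assumes setting: "vmc_setting \<Omega> N D H \<psi>"
    and lam: "lam > 0"
    and mu: "0 \<le> \<mu>" "\<mu> < 1"
    and Cm: "C\<^sub>m > 0"
    and score_moment:
      "\<And>t. (\<integral>\<^sup>+x. ennreal (norm (score \<psi> t x) ^ 4) \<partial>vmc_density M \<psi> t) \<le> ennreal C\<^sub>m"
    and energy_moment:
      "\<And>t. (\<integral>\<^sup>+x. ennreal (local_energy H \<psi> t x ^ 4) \<partial>vmc_density M \<psi> t) \<le> ennreal C\<^sub>m"
    and Cg: "C\<^sub>g > 0"
    and Lipschitz: "\<And>t t'. norm (g t - g t') \<le> C\<^sub>g * norm (t - t')"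
    and step_mono: "\<And>k. k \<ge> 1 \<Longrightarrow> 0 < \<eta> k \<and> \<eta> k \<le> \<eta> (k - 1)"
    and step_init: "0 < \<eta> 0" "\<eta> 0 \<le> 2 * lam * (1 - \<mu>) / C\<^sub>g"
    and iteration: "full_batch_SPRING M H \<psi> lam \<mu> \<eta> \<theta>\<^sub>0 \<Delta>\<^sub>0 \<theta> \<Delta>"
  shows
    "(filterlim (\<lambda>n. \<Sum>k<n. \<eta> k) at_top sequentially \<longrightarrow>
        (\<lambda>K. Min ((\<lambda>k. (norm (g (\<theta> k)))\<^sup>2) ` {1..K})) \<in> O(\<lambda>K. 1 / (\<Sum>k=1..K. \<eta> k)) \<and>
        liminf (\<lambda>k. ereal (norm (g (\<theta> k)))) = 0)
     \<and> ((\<exists>c>0. \<forall>k. \<eta> k = c) \<longrightarrow> (\<lambda>k. g (\<theta> k)) \<longlonglongrightarrow> 0)"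
proof -
  interpret vmc_setting \<Omega> N D H \<psi> by (rule setting)
  have eta: "0 < \<eta> k" for k using step_mono[of k] step_init(1) by (cases "k = 0") auto
  define prev where "prev k = (case k of 0 \<Rightarrow> \<Delta>\<^sub>0 | Suc j \<Rightarrow> \<Delta> j)" for k
  define A where "A k = SR_matrix M \<psi> (\<theta> k)" for k
  have score': "(\<integral>\<^sup>+x. ennreal (norm (score \<psi> t x) ^ 4) \<partial>vmc_density (config_space \<Omega> N) \<psi> t) \<le> ennreal C\<^sub>m"
    for t using score_moment[of t] by (simp add: M_def)
  have A_nonneg: "0 \<le> (A k *v v) \<bullet> v" for k v
    using SR_matrix_nonneg[OF score'] Cm by (simp add: A_def M_def)
  have A_bound: "norm (A k *v v) \<le> (2 * (1 + C\<^sub>m) + 2 * (1 + C\<^sub>m)\<^sup>2) * norm v" for k v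
    using SR_matrix_bounded[OF score'] Cm by (simp add: A_def M_def)
  have step: "\<theta> (Suc k) = \<theta> k + \<eta> k *\<^sub>R \<Delta> k"
    and \<Delta>: "\<Delta> k = matrix_inv (lam *\<^sub>R mat 1 + A k) *v ((lam * \<mu>) *\<^sub>R prev k - (1/2) *\<^sub>R g (\<theta> k))" for k
    using iteration unfolding full_batch_SPRING_def A_def prev_def g_def by blast+
  \<comment> \<open>Multiplying the update by the regularized matrix undoes
    \<open>matrix_inv\<close>, which is a genuine inverse by \<open>A_nonneg\<close> and
    \<open>lam\<close>.\<close>
  have direction: "lam *\<^sub>R \<Delta> k + A k *v \<Delta> k = (lam * \<mu>) *\<^sub>R prev k - (1/2) *\<^sub>R g (\<theta> k)" for k
  proof -
    have "lam *\<^sub>R \<Delta> k + A k *v \<Delta> k = (lam *\<^sub>R mat 1 + A k) *v \<Delta> k"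
      by (simp add: matrix_vector_mult_add_rdistrib scaleR_matrix_vector_assoc[symmetric])
    also have "\<dots> = (lam * \<mu>) *\<^sub>R prev k - (1/2) *\<^sub>R g (\<theta> k)"
      using invertible_regularized[OF A_nonneg lam, of k]
      by (subst \<Delta>) (simp add: matrix_vector_mul_assoc mult_matrix_inv)
    finally show ?thesis .
  qed
  have "summable (\<lambda>k. \<eta> k * (norm (g (\<theta> k)))\<^sup>2)"
  proof (rule spring_summable[where L = "energy M H \<psi>" and g = g and \<theta> = \<theta> and \<Delta> = \<Delta>
        and prev = prev and A = "\<lambda>k v. A k *v v" and m = "- (1 + C\<^sub>m)"])
    show "GDERIV (energy M H \<psi>) x :> g x" for x
      using has_gradient_gradient[OF energy_differentiable[of x]]
      by (simp add: g_def energy_gradient_def M_def)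
    show "- (1 + C\<^sub>m) \<le> energy M H \<psi> x" for x
      using energy_bounded_below energy_moment[of x] Cm by (simp add: M_def)
    show "\<eta> (Suc k) \<le> \<eta> k" for k using step_mono[of "Suc k"] by simp
    show "prev (Suc k) = \<Delta> k" for k by (simp add: prev_def)
  qed (fact Lipschitz Cg lam mu eta step_init(2) A_nonneg A_bound direction step)+
  note sm = this
  show ?thesis
  proof (intro conjI impI)
    show "(\<lambda>K. Min ((\<lambda>k. (norm (g (\<theta> k)))\<^sup>2) ` {1..K})) \<in> O(\<lambda>K. 1 / (\<Sum>k=1..K. \<eta> k))"
      by (rule Min_bigo_of_summable_weighted[OF eta _ sm]) simp
    show "liminf (\<lambda>k. ereal (norm (g (\<theta> k)))) = 0"
      if "filterlim (\<lambda>n. \<Sum>k<n. \<eta> k) at_top sequentially"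
      by (rule liminf_zero_of_summable_weighted[OF eta _ sm that]) simp
    assume "\<exists>c>0. \<forall>k. \<eta> k = c"
    then obtain c where c: "c > 0" "\<And>k. \<eta> k = c" by blast
    \<comment> \<open>The constant positive weight cancels, so the squared gradient norms are terms
      of a convergent series.\<close>
    then have "summable (\<lambda>k. (norm (g (\<theta> k)))\<^sup>2)" using sm by simp
    then have "(\<lambda>k. (norm (g (\<theta> k)))\<^sup>2) \<longlonglongrightarrow> 0" by (rule summable_LIMSEQ_zero)
    then have "(\<lambda>k. norm (g (\<theta> k))) \<longlonglongrightarrow> 0" using tendsto_real_sqrt by fastforce
    then show "(\<lambda>k. g (\<theta> k)) \<longlonglongrightarrow> 0" by (simp add: tendsto_norm_zero_iff)
  qed
qed

end
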